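(* The number of antichains in $\{0,1,2\}^n$ is $2^{\left(1+O\left(\sqrt{\log{n}/n}\right)\right)\ell_n(n)}$ as $n\to\infty$.
   Context: $\{0,1,2\}^n$ is the poset in which $x\leq y$ if and only if $x_j\leq y_j$ for all $1\leq j\leq n$. For $0\leq i\leq 2n$, $\ell_i(n)$ denotes the number of vectors in $\{0,1,2\}^n$ whose coordinates sum to $i$. An antichain is a set of pairwise incomparable elements. *)

theory Defs
  imports Complex_Main "HOL-Library.Landau_Symbols"
begin

definition cube :: "nat \<Rightarrow> nat list set" where
  "cube n = {xs. length xs = n \<and> set xs \<subseteq> {0, 1, 2}}"

definition vec_le :: "nat list \<Rightarrow> nat list \<Rightarrow> bool" where
  "vec_le xs ys \<longleftrightarrow> length xs = length ys \<and> (\<forall>j<length xs. xs ! j \<le> ys ! j)"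

definition is_antichain :: "nat list set \<Rightarrow> bool" where
  "is_antichain A \<longleftrightarrow> (\<forall>x\<in>A. \<forall>y\<in>A. x \<noteq> y \<longrightarrow> \<not> vec_le x y \<and> \<not> vec_le y x)"

definition num_antichains :: "nat \<Rightarrow> nat" where
  "num_antichains n = card {A. A \<subseteq> cube n \<and> is_antichain A}"

definition level_size :: "nat \<Rightarrow> nat \<Rightarrow> nat" where
  "level_size n i = card {x \<in> cube n. sum_list x = i}"

end

theory Submission
  imports Defs "HOL-Combinatorics.Permutations" "HOL-Analysis.Convex" "HOL-Real_Asymp.Real_Asymp"
begin

text \<open>The cube splits into \<open>L = \<ell>\<^sub>n(n)\<close> symmetric chains. Permute the coordinates at random. For any set
  \<open>S\<close>, Cauchy-Schwarz gives at least \<open>|S|\<^sup>2 / L - |S|\<close> ordered pairs of distinct elements of \<open>S\<close> whose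
  images share a chain, while a fixed pair \<open>x < y\<close> does so with probability at most \<open>8 / n\<close> if \<open>y\<close> has
  at least \<open>n / 8\<close> zeros and ones: the stabilizer of \<open>x\<close> moves \<open>y\<close> to that many elements of one level.
  So some vertex of the comparability graph on \<open>S\<close> has degree at least \<open>n (|S| - L) / (8 L)\<close>. Branching
  on vertices of large degree, as in the graph container algorithm, shrinks the excess \<open>|S| - L\<close>
  geometrically, and yields the bound \<open>(1 + O((log n)\<^sup>2 / n)) L\<close> on the logarithm of the number of
  antichains, which is stronger than needed. The vectors with few zeros or ones are exponentially
  rare and contribute a negligible factor.\<close>

section \<open>The cube\<close>

lemma cube_0: "cube 0 = {[]}"
  by (auto simp: cube_def)

lemma cube_Suc: "cube (Suc n) = (\<lambda>(v, x). v # x) ` ({0, 1, 2} \<times> cube n)"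
proof -
  have "xs \<in> (\<lambda>(v, x). v # x) ` ({0, 1, 2} \<times> cube n)" if "xs \<in> cube (Suc n)" for xs
    using that by (cases xs) (auto simp: cube_def image_iff)
  then show ?thesis
    by (auto simp: cube_def)
qed

lemma finite_cube: "finite (cube n)"
  by (induction n) (auto simp: cube_0 cube_Suc)

lemma sum_cube_Suc:
  fixes f :: "nat list \<Rightarrow> 'a :: comm_monoid_add"
  shows "(\<Sum>x\<in>cube (Suc n). f x) = (\<Sum>x\<in>cube n. f (0 # x) + f (1 # x) + f (2 # x))"
proof -
  have "(\<Sum>x\<in>cube (Suc n). f x) = (\<Sum>(v, x)\<in>{0, 1, 2} \<times> cube n. f (v # x))"
    unfolding cube_Suc by (subst sum.reindex) (auto simp: inj_on_def case_prod_unfold)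
  also have "\<dots> = (\<Sum>v\<in>{0, 1, 2}. \<Sum>x\<in>cube n. f (v # x))"
    by (rule sum.cartesian_product[symmetric])
  also have "\<dots> = (\<Sum>x\<in>cube n. f (0 # x) + f (1 # x) + f (2 # x))"
    by (simp add: sum.distrib add.assoc)
  finally show ?thesis .
qed

lemma card_cube: "card (cube n) = 3 ^ n"
proof (induction n)
  case (Suc n)
  have "card (cube (Suc n)) = (\<Sum>x\<in>cube n. 3)"
    using sum_cube_Suc[of "\<lambda>_. 1::nat" n] by (simp add: numeral_3_eq_3)
  with Suc show ?case by simp
qed (simp add: cube_0)

lemma vec_le_Cons: "vec_le (v # x) (w # y) \<longleftrightarrow> v \<le> w \<and> vec_le x y"
  by (auto simp: vec_le_def nth_Cons split: nat.splits)

lemma vec_le_antisym: "vec_le x y \<Longrightarrow> vec_le y x \<Longrightarrow> x = y"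
  by (auto simp: vec_le_def intro!: nth_equalityI order_antisym)

section \<open>A symmetric chain decomposition\<close>

text \<open>If \<open>x\<close> sits at position \<open>i\<close> of a chain \<open>c\<^sub>0 < \<dots> < c\<^sub>h\<close>, then the product of that chain with
  \<open>{0, 1, 2}\<close> splits into the chains numbered \<open>c = 0, 1, 2\<close>: chain \<open>c\<close> runs through
  \<open>(c, c\<^sub>0), \<dots>, (c, c\<^bsub>h-c\<^esub>)\<close> and then through \<open>(c + 1, c\<^bsub>h-c\<^esub>), \<dots>, (2, c\<^bsub>h-c\<^esub>)\<close>. The list of these
  numbers is the name of the chain.\<close>

fun chain_height :: "nat list \<Rightarrow> nat" where
  "chain_height [] = 0"
| "chain_height (c # k) = chain_height k + 2 - 2 * c"

fun chain_name :: "nat list \<Rightarrow> nat list" and chain_pos :: "nat list \<Rightarrow> nat" where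
  "chain_name [] = []"
| "chain_name (v # x) = min v (chain_height (chain_name x) - chain_pos x) # chain_name x"
| "chain_pos [] = 0"
| "chain_pos (v # x) = chain_pos x + v - min v (chain_height (chain_name x) - chain_pos x)"

text \<open>Makes the truncated differences \<open>chain_height (chain_name x) - chain_pos x\<close>
  in the recursion genuine ones.\<close>

lemma chain_pos_le_height: "x \<in> cube n \<Longrightarrow> chain_pos x \<le> chain_height (chain_name x)"
  by (induction n arbitrary: x) (fastforce simp: cube_0 cube_Suc min_def)+

text \<open>This is the symmetry of the chains: one of height \<open>h\<close> starts at coordinate
  sum \<open>n - h / 2\<close>, and each step up adds one. Doubling avoids fractions and
  subtraction.\<close>

lemma sum_list_eq_chain_pos:
  "x \<in> cube n \<Longrightarrow> 2 * sum_list x + chain_height (chain_name x) = 2 * n + 2 * chain_pos x"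
proof (induction n arbitrary: x)
  case (Suc n)
  then obtain v y where x: "x = v # y" "y \<in> cube n" "v \<le> 2"
    by (fastforce simp: cube_Suc)
  obtain d where d: "chain_height (chain_name y) = chain_pos y + d"
    using chain_pos_le_height[OF x(2)] le_Suc_ex by blast
  have "2 * sum_list y + d = 2 * n + chain_pos y"
    using Suc.IH[OF x(2)] d by simp
  then show ?case
    using x(1,3) d by (cases "v \<le> d") (simp_all add: min_def)
qed (simp add: cube_0)

lemma chain_pos_surj:
  "x \<in> cube n \<Longrightarrow> j \<le> chain_height (chain_name x) \<Longrightarrow>
    \<exists>y\<in>cube n. chain_name y = chain_name x \<and> chain_pos y = j"
proof (induction n arbitrary: x j)
  case (Suc n)
  then obtain v x' where x: "x = v # x'" "x' \<in> cube n" "v \<le> 2"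
    by (fastforce simp: cube_Suc)
  define h where "h = chain_height (chain_name x')"
  define c where "c = min v (h - chain_pos x')"
  have i: "chain_pos x' \<le> h"
    using chain_pos_le_height[OF x(2)] by (simp add: h_def)
  have c: "c \<le> h" "c \<le> 2" and j: "j \<le> h + 2 - 2 * c"
    using x Suc.prems(2) by (auto simp: c_def h_def)
  \<comment> \<open>Chain \<open>c\<close> of the product first climbs the old chain up to position
    \<open>h - c\<close> with first coordinate \<open>c\<close>; the remaining steps raise that
    coordinate.\<close>
  define i' where "i' = min j (h - c)"
  define v' where "v' = j + c - i'"
  have i': "i' \<le> h" and v': "v' \<le> 2" "min v' (h - i') = c" "i' + v' - c = j"
    using c j by (auto simp: i'_def v'_def min_def)
  obtain y where y: "y \<in> cube n" "chain_name y = chain_name x'" "chain_pos y = i'"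
    using Suc.IH[OF x(2), of i'] i' by (auto simp: h_def)
  have "v' \<in> {0, 1, 2}"
    using v'(1) by auto
  then have "v' # y \<in> cube (Suc n)"
    using y(1) by (auto simp: cube_Suc)
  moreover have "chain_name (v' # y) = chain_name x \<and> chain_pos (v' # y) = j"
    using y v' by (simp add: x(1) c_def h_def)
  ultimately show ?case by blast
qed (auto simp: cube_0)

lemma chain_name_eq_imp_vec_le:
  "x \<in> cube n \<Longrightarrow> y \<in> cube n \<Longrightarrow> chain_name x = chain_name y \<Longrightarrow> chain_pos x \<le> chain_pos y \<Longrightarrow>
    vec_le x y"
proof (induction n arbitrary: x y)
  case (Suc n)
  then obtain v x' w y' where
    xy: "x = v # x'" "y = w # y'" "x' \<in> cube n" "y' \<in> cube n"
    by (fastforce simp: cube_Suc)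
  define h where "h = chain_height (chain_name x')"
  have k: "chain_name x' = chain_name y'"
    using Suc.prems(3) xy by simp
  obtain d e where de: "h = chain_pos x' + d" "h = chain_pos y' + e"
    using chain_pos_le_height[OF xy(3)] chain_pos_le_height[OF xy(4)] k le_Suc_ex
    by (metis h_def)
  then have sub: "h - chain_pos x' = d" "h - chain_pos y' = e"
    by simp_all
  have "min v d = min w e"
    using Suc.prems(3) xy k sub by (simp add: h_def)
  moreover have "chain_pos x' + v - min v d \<le> chain_pos y' + w - min w e"
    using Suc.prems(4) xy k sub by (simp add: h_def)
  \<comment> \<open>On the first leg only the old position moves, on the second only the first
    coordinate, so the order of positions on the new chain orders both.\<close>
  ultimately have "chain_pos x' \<le> chain_pos y' \<and> v \<le> w"
    using de by (cases "v \<le> d"; cases "w \<le> e") (simp_all add: min_def)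
  with Suc.IH[OF xy(3,4) k] show ?case
    by (simp add: xy vec_le_Cons)
qed (simp add: cube_0 vec_le_def)

lemma chain_name_eq_imp_comparable:
  "x \<in> cube n \<Longrightarrow> y \<in> cube n \<Longrightarrow> chain_name x = chain_name y \<Longrightarrow> vec_le x y \<or> vec_le y x"
  using chain_name_eq_imp_vec_le nat_le_linear by metis

text \<open>The sum determines the position on a chain, so a chain meets each level at most
  once.\<close>

lemma chain_name_sum_list_inj:
  assumes "x \<in> cube n" "y \<in> cube n" "chain_name x = chain_name y" "sum_list x = sum_list y"
  shows "x = y"
proof -
  have "chain_pos x = chain_pos y"
    using sum_list_eq_chain_pos[OF assms(1)] sum_list_eq_chain_pos[OF assms(2)] assms(3,4) by simp
  then show ?thesis
    using assms chain_name_eq_imp_vec_le[of x n y] chain_name_eq_imp_vec_le[of y n x]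
    by (simp add: vec_le_antisym)
qed

text \<open>By symmetry every chain passes through the middle level, at half its height.\<close>

lemma card_chain_names_le: "card (chain_name ` cube n) \<le> level_size n n"
proof -
  have "chain_name ` cube n \<subseteq> chain_name ` {x \<in> cube n. sum_list x = n}"
  proof
    fix k assume "k \<in> chain_name ` cube n"
    then obtain x where x: "x \<in> cube n" "k = chain_name x" by blast
    obtain y where y: "y \<in> cube n" "chain_name y = k" "chain_pos y = chain_height k div 2"
      using chain_pos_surj[OF x(1), of "chain_height k div 2"] x(2) by auto
    \<comment> \<open>The height is therefore even and the halving is exact.\<close>
    have "even (2 * sum_list y + chain_height k)"
      using sum_list_eq_chain_pos[OF y(1)] y(2) by simp
    then have "sum_list y = n"
      using sum_list_eq_chain_pos[OF y(1)] y(2,3) by auto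
    with y show "k \<in> chain_name ` {x \<in> cube n. sum_list x = n}" by blast
  qed
  then have "card (chain_name ` cube n) \<le> card (chain_name ` {x \<in> cube n. sum_list x = n})"
    by (intro card_mono) (auto simp: finite_cube)
  also have "\<dots> \<le> level_size n n"
    unfolding level_size_def by (intro card_image_le) (auto simp: finite_cube)
  finally show ?thesis .
qed

lemma sum_list_cube_le: "x \<in> cube n \<Longrightarrow> sum_list x \<le> 2 * n"
  by (induction n arbitrary: x) (fastforce simp: cube_0 cube_Suc)+

text \<open>A vector is determined by its chain and its sum. The resulting lower bound on the middle
  level later turns quantities relative to \<open>3 ^ n\<close> into quantities relative to
  \<open>level_size n n\<close>.\<close>

lemma three_power_le_level_size: "3 ^ n \<le> (2 * n + 1) * level_size n n"
proof -
  have "inj_on (\<lambda>x. (chain_name x, sum_list x)) (cube n)"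
    by (auto intro!: inj_onI chain_name_sum_list_inj)
  then have "3 ^ n = card ((\<lambda>x. (chain_name x, sum_list x)) ` cube n)"
    by (simp add: card_image card_cube)
  also have "\<dots> \<le> card (chain_name ` cube n \<times> {..2 * n})"
    by (intro card_mono) (auto simp: finite_cube sum_list_cube_le)
  also have "\<dots> \<le> (2 * n + 1) * level_size n n"
    using mult_right_mono[OF card_chain_names_le[of n], of "2 * n + 1"]
    by (simp add: card_cartesian_product mult.commute)
  finally show ?thesis .
qed

lemma level_size_pos: "level_size n n > 0"
  using three_power_le_level_size[of n] by (cases "level_size n n") auto

section \<open>Averaging over coordinate permutations\<close>

lemma permute_list_in_cube: "p permutes {..<n} \<Longrightarrow> x \<in> cube n \<Longrightarrow> permute_list p x \<in> cube n"
  by (auto simp: cube_def)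

lemma inj_on_permute_list:
  assumes "p permutes {..<n}" shows "inj_on (permute_list p) (cube n)"
proof (rule inj_onI)
  fix x y assume xy: "x \<in> cube n" "y \<in> cube n" "permute_list p x = permute_list p y"
  have "permute_list (inv p) (permute_list p z) = z" if "z \<in> cube n" for z
    using that assms permutes_inv[OF assms]
    by (auto simp: cube_def permute_list_compose[symmetric] permutes_inv_o)
  with xy show "x = y" by metis
qed

lemma sum_list_permute_list: "p permutes {..<length x} \<Longrightarrow> sum_list (permute_list p x) = sum_list (x :: nat list)"
  by (metis mset_permute_list sum_mset_sum_list)

definition perms_same_chain :: "nat \<Rightarrow> nat list \<Rightarrow> nat list \<Rightarrow> (nat \<Rightarrow> nat) set" where
  "perms_same_chain n x y =
    {p. p permutes {..<n} \<and> chain_name (permute_list p x) = chain_name (permute_list p y)}"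

lemma finite_perms_same_chain: "finite (perms_same_chain n x y)"
  unfolding perms_same_chain_def by (rule finite_subset[OF _ finite_permutations[of "{..<n}"]]) auto

text \<open>Permuting lists is a right action: \<open>h \<circ> p\<close> acts as \<open>h\<close>
  followed by \<open>p\<close>. As \<open>h\<close> fixes \<open>x\<close>, composing with
  \<open>h\<close> on the left is the bijection.\<close>

lemma card_perms_same_chain_stabilizer:
  assumes "x \<in> cube n" "y \<in> cube n" "h permutes {..<n}" "permute_list h x = x"
  shows "card (perms_same_chain n x (permute_list h y)) = card (perms_same_chain n x y)"
proof (rule bij_betw_same_card)
  have len: "length x = n" "length y = n"
    using assms by (auto simp: cube_def)
  show "bij_betw (\<lambda>p. h \<circ> p) (perms_same_chain n x (permute_list h y)) (perms_same_chain n x y)"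
  proof (rule bij_betwI[where g = "\<lambda>p. inv h \<circ> p"])
    show "(\<lambda>p. h \<circ> p) \<in> perms_same_chain n x (permute_list h y) \<rightarrow> perms_same_chain n x y"
      using assms len by (auto simp: perms_same_chain_def permute_list_compose permutes_compose)
    show "(\<lambda>p. inv h \<circ> p) \<in> perms_same_chain n x y \<rightarrow> perms_same_chain n x (permute_list h y)"
    proof
      fix p assume p: "p \<in> perms_same_chain n x y"
      then have q: "inv h \<circ> p permutes {..<n}" and hq: "h \<circ> (inv h \<circ> p) = p"
        using assms(3) permutes_inv[OF assms(3)]
        by (auto simp: perms_same_chain_def permutes_compose o_assoc permutes_inv_o)
      have inv_h: "permute_list (inv h \<circ> p) (permute_list h z) = permute_list p z" if "length z = n" for z
        using permute_list_compose[of "inv h \<circ> p" z h] that q hq by simp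
      then show "inv h \<circ> p \<in> perms_same_chain n x (permute_list h y)"
        using q p inv_h[of x] inv_h[of y] assms(4) len by (simp add: perms_same_chain_def)
    qed
  qed (use assms(3) in \<open>auto simp: o_assoc permutes_inv_o\<close>)
qed

text \<open>The images \<open>h i y\<close> are distinct and lie on the same level, hence for each permutation at most
  one of them is on the chain of the image of \<open>x\<close>.\<close>

lemma card_perms_same_chain_le:
  assumes x: "x \<in> cube n" and y: "y \<in> cube n" and "finite I"
    and h: "\<And>i. i \<in> I \<Longrightarrow> h i permutes {..<n}" "\<And>i. i \<in> I \<Longrightarrow> permute_list (h i) x = x"
    and inj: "inj_on (\<lambda>i. permute_list (h i) y) I"
  shows "card I * card (perms_same_chain n x y) \<le> fact n"
proof -
  have disj: "i = j"
    if ij: "i \<in> I" "j \<in> I" and p: "p \<in> perms_same_chain n x (permute_list (h i) y)"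
      "p \<in> perms_same_chain n x (permute_list (h j) y)" for i j p
  proof -
    have perm: "p permutes {..<n}"
      and eq: "chain_name (permute_list p (permute_list (h i) y)) =
        chain_name (permute_list p (permute_list (h j) y))"
      using p by (auto simp: perms_same_chain_def)
    have in_cube: "permute_list (h i) y \<in> cube n" "permute_list (h j) y \<in> cube n"
      using h ij y by (auto intro: permute_list_in_cube)
    have "sum_list (permute_list p (permute_list (h i) y)) =
        sum_list (permute_list p (permute_list (h j) y))"
      using perm h(1)[OF ij(1)] h(1)[OF ij(2)] y
      by (simp add: sum_list_permute_list cube_def)
    then have "permute_list p (permute_list (h i) y) = permute_list p (permute_list (h j) y)"
      by (rule chain_name_sum_list_inj[OF permute_list_in_cube[OF perm in_cube(1)]
            permute_list_in_cube[OF perm in_cube(2)] eq])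
    then have "permute_list (h i) y = permute_list (h j) y"
      using inj_on_permute_list[OF perm] in_cube by (rule_tac inj_onD)
    with inj show ?thesis using ij by (rule inj_onD)
  qed
  have "card I * card (perms_same_chain n x y) =
      (\<Sum>i\<in>I. card (perms_same_chain n x (permute_list (h i) y)))"
    using card_perms_same_chain_stabilizer[OF x y] h by simp
  also have "\<dots> = card (\<Union>i\<in>I. perms_same_chain n x (permute_list (h i) y))"
    using disj by (intro card_UN_disjoint[symmetric] \<open>finite I\<close>) (blast intro: finite_perms_same_chain)+
  also have "\<dots> \<le> card {p. p permutes {..<n}}"
    by (intro card_mono finite_permutations) (auto simp: perms_same_chain_def)
  also have "\<dots> = fact n"
    by (simp add: card_permutations)
  finally show ?thesis .
qed

text \<open>The permutations used are the transpositions of \<open>p\<close> with the positions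
  \<open>q\<close> where \<open>y\<close> has value \<open>a\<close>. They fix \<open>x\<close>,
  which has value \<open>a\<close> at both places, and carry the different value
  \<open>y ! p\<close> to distinct positions.\<close>

lemma card_perms_same_chain_le_fibre:
  assumes x: "x \<in> cube n" and y: "y \<in> cube n" and p: "p < n" "x ! p = a" "y ! p \<noteq> a"
    and fix_x: "\<And>q. q < n \<Longrightarrow> y ! q = a \<Longrightarrow> x ! q = a"
  shows "count_list y a * card (perms_same_chain n x y) \<le> fact n"
proof -
  have len: "length x = n" "length y = n"
    using x y by (auto simp: cube_def)
  define I where "I = {q. q < n \<and> y ! q = a}"
  have nth: "permute_list (transpose p q) z ! r = z ! transpose p q r"
    if "q < n" "r < n" "length z = n" for q r z
    using that p(1) permutes_swap_id[of p "{..<n}" q] by (intro permute_list_nth) auto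
  have "card I * card (perms_same_chain n x y) \<le> fact n"
  proof (rule card_perms_same_chain_le[OF x y, where h = "\<lambda>q. transpose p q"])
    show "transpose p q permutes {..<n}" if "q \<in> I" for q
      using that p(1) by (auto simp: I_def intro: permutes_swap_id)
    show "permute_list (transpose p q) x = x" if "q \<in> I" for q
    proof (rule nth_equalityI)
      fix r assume "r < length (permute_list (transpose p q) x)"
      then show "permute_list (transpose p q) x ! r = x ! r"
        using that p(1,2) fix_x[of q] len by (auto simp: I_def nth transpose_def)
    qed simp
    show "inj_on (\<lambda>q. permute_list (transpose p q) y) I"
    proof (rule inj_onI, rule ccontr)
      fix q r assume qr: "q \<in> I" "r \<in> I"
        "permute_list (transpose p q) y = permute_list (transpose p r) y" "q \<noteq> r"
      \<comment> \<open>At position \<open>q\<close> the first list has \<open>y ! p\<close>, the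
        second still has \<open>y ! q = a\<close>.\<close>
      then have "y ! transpose p q q = y ! transpose p r q"
        using nth[of q q y] nth[of r q y] len by (auto simp: I_def)
      then have "y ! p = y ! transpose p r q" by simp
      with qr p show False
        by (auto simp: I_def transpose_def split: if_splits)
    qed
  qed (simp add: I_def)
  moreover have "card I = count_list y a"
  proof -
    have "I = {i. i < length y \<and> a = y ! i}"
      using len by (auto simp: I_def)
    then show ?thesis
      by (simp add: count_list_eq_length_filter length_filter_conv_card)
  qed
  ultimately show ?thesis by simp
qed

text \<open>0 and 1 are the values from which a coordinate can strictly increase; the threshold
  \<open>n / 8\<close> lies well below the average count \<open>n / 3\<close>.\<close>

definition typical :: "nat \<Rightarrow> nat list set" where
  "typical n = {x \<in> cube n. n \<le> 8 * count_list x 0 \<and> n \<le> 8 * count_list x 1}"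

text \<open>If some coordinate rises from 0, the fibre \<open>a = 0\<close> works, since zeros of
  \<open>y\<close> are zeros of \<open>x\<close>. Otherwise \<open>x\<close> and \<open>y\<close>
  have the same zeros, so some coordinate rises from 1 to 2 and every 1 of \<open>y\<close> is a 1
  of \<open>x\<close>: take \<open>a = 1\<close>.\<close>

lemma card_perms_same_chain_le_typical:
  assumes "x \<in> cube n" "y \<in> typical n" "vec_le x y" "x \<noteq> y"
  shows "n * card (perms_same_chain n x y) \<le> 8 * fact n"
proof -
  have y: "y \<in> cube n" "n \<le> 8 * count_list y 0" "n \<le> 8 * count_list y 1"
    using assms(2) by (auto simp: typical_def)
  have len: "length x = n" "length y = n"
    using assms(1) y by (auto simp: cube_def)
  have le: "x ! q \<le> y ! q" if "q < n" for q
    using assms(3) that len by (simp add: vec_le_def)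
  have "\<exists>a\<in>{0, 1}. count_list y a * card (perms_same_chain n x y) \<le> fact n"
  proof (cases "\<exists>p<n. x ! p = 0 \<and> y ! p \<noteq> 0")
    case True
    then obtain p where "p < n" "x ! p = 0" "y ! p \<noteq> 0" by blast
    then have "count_list y 0 * card (perms_same_chain n x y) \<le> fact n"
      by (rule card_perms_same_chain_le_fibre[OF assms(1) y(1)]) (use le in fastforce)
    then show ?thesis by blast
  next
    case False
    obtain p where p: "p < n" "x ! p \<noteq> y ! p"
      using assms(4) len by (metis nth_equalityI)
    have "y ! p \<in> {0, 1, 2}"
      using y(1) nth_mem[of p y] p(1) len(2) unfolding cube_def by (metis (lifting) mem_Collect_eq subsetD)
    then have "x ! p = 1" "y ! p \<noteq> 1"
      using False p le[of p] by auto
    moreover have "x ! q = 1" if "q < n" "y ! q = 1" for q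
      using le[of q] False that by fastforce
    ultimately have "count_list y 1 * card (perms_same_chain n x y) \<le> fact n"
      by (intro card_perms_same_chain_le_fibre[OF assms(1) y(1) p(1)]) auto
    then show ?thesis by blast
  qed
  then obtain a where a: "a \<in> {0, 1}" "count_list y a * card (perms_same_chain n x y) \<le> fact n"
    by blast
  then have "n * card (perms_same_chain n x y) \<le> 8 * count_list y a * card (perms_same_chain n x y)"
    using y by (intro mult_right_mono) auto
  also have "\<dots> \<le> 8 * fact n"
    using a(2) by simp
  finally show ?thesis .
qed

section \<open>Supersaturation\<close>

definition comparable :: "nat list \<Rightarrow> nat list \<Rightarrow> bool" where
  "comparable x y \<longleftrightarrow> x \<noteq> y \<and> (vec_le x y \<or> vec_le y x)"

lemma vec_le_permute_list:
  assumes "p permutes {..<n}" "x \<in> cube n" "y \<in> cube n"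
    and "vec_le (permute_list p x) (permute_list p y)"
  shows "vec_le x y"
proof -
  have len: "length x = n" "length y = n"
    using assms(2,3) by (auto simp: cube_def)
  have "x ! j \<le> y ! j" if "j < n" for j
  proof -
    have "j \<in> p ` {..<n}"
      using permutes_image[OF assms(1)] that by simp
    then obtain i where i: "i < n" "p i = j"
      by blast
    then have "permute_list p x ! i \<le> permute_list p y ! i"
      using assms(4) len by (simp add: vec_le_def)
    then show ?thesis
      using i assms(1) len by (simp add: permute_list_nth)
  qed
  then show ?thesis
    using len by (simp add: vec_le_def)
qed

lemma perms_same_chain_imp_comparable:
  assumes "x \<in> cube n" "y \<in> cube n" "x \<noteq> y" "p \<in> perms_same_chain n x y"
  shows "comparable x y"
proof -
  have p: "p permutes {..<n}" "chain_name (permute_list p x) = chain_name (permute_list p y)"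
    using assms(4) by (auto simp: perms_same_chain_def)
  show ?thesis
    using chain_name_eq_imp_comparable[OF permute_list_in_cube[OF p(1) assms(1)]
        permute_list_in_cube[OF p(1) assms(2)] p(2)] vec_le_permute_list[OF p(1)] assms(1-3)
    by (auto simp: comparable_def)
qed

lemma card_perms_same_chain_le_comparable:
  assumes "x \<in> typical n" "y \<in> typical n" "comparable x y"
  shows "n * card (perms_same_chain n x y) \<le> 8 * fact n"
proof -
  have "perms_same_chain n y x = perms_same_chain n x y"
    by (auto simp: perms_same_chain_def)
  moreover have "x \<in> cube n" "y \<in> cube n"
    using assms by (auto simp: typical_def)
  ultimately show ?thesis
    using assms card_perms_same_chain_le_typical[of x n y] card_perms_same_chain_le_typical[of y n x]
    by (auto simp: comparable_def)
qed

text \<open>Cauchy-Schwarz over the at most \<open>m\<close> fibres of \<open>f\<close>. The pairs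
  are ordered and include the diagonal.\<close>

lemma card_squared_le_card_same_image:
  assumes "finite S" "card (f ` S) \<le> m"
  shows "(card S)\<^sup>2 \<le> m * card {(x, y) \<in> S \<times> S. f x = f y}"
proof -
  define c where "c k = card {x \<in> S. f x = k}" for k
  have "{(x, y) \<in> S \<times> S. f x = f y} = (\<Union>k\<in>f ` S. {x \<in> S. f x = k} \<times> {x \<in> S. f x = k})"
    by auto
  also have "card \<dots> = (\<Sum>k\<in>f ` S. c k * c k)"
    using assms(1) by (subst card_UN_disjoint) (auto simp: c_def card_cartesian_product)
  finally have pairs: "card {(x, y) \<in> S \<times> S. f x = f y} = (\<Sum>k\<in>f ` S. c k * c k)" .
  have "card S = (\<Sum>k\<in>f ` S. c k)"
    using sum.image_gen[OF assms(1), of "\<lambda>_. 1::nat" f] by (simp add: c_def)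
  then have "(real (card S))\<^sup>2 = (\<Sum>k\<in>f ` S. real (c k))\<^sup>2"
    by simp
  also have "\<dots> \<le> real (card (f ` S)) * (\<Sum>k\<in>f ` S. (real (c k))\<^sup>2)"
    using sum_squared_le_sum_of_squares[of "\<lambda>k. real (c k)" "f ` S"] by (simp add: mult.commute)
  also have "\<dots> \<le> real m * (\<Sum>k\<in>f ` S. (real (c k))\<^sup>2)"
    using assms(2) by (intro mult_right_mono sum_nonneg) auto
  also have "\<dots> = real (m * card {(x, y) \<in> S \<times> S. f x = f y})"
    unfolding pairs by (simp add: power2_eq_square)
  finally have "real ((card S)\<^sup>2) \<le> real (m * card {(x, y) \<in> S \<times> S. f x = f y})"
    by simp
  then show ?thesis
    unfolding of_nat_le_iff .
qed

lemma sum_card_swap: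
  assumes "finite A" "finite B"
  shows "(\<Sum>a\<in>A. card {b \<in> B. R a b}) = (\<Sum>b\<in>B. card {a \<in> A. R a b})"
proof -
  have "(\<Sum>a\<in>A. card {b \<in> B. R a b}) = (\<Sum>a\<in>A. \<Sum>b\<in>B. if R a b then 1 else 0)"
    using assms by (simp flip: sum.inter_filter)
  also have "\<dots> = (\<Sum>b\<in>B. \<Sum>a\<in>A. if R a b then 1 else 0)"
    by (rule sum.swap)
  also have "\<dots> = (\<Sum>b\<in>B. card {a \<in> A. R a b})"
    using assms by (simp flip: sum.inter_filter)
  finally show ?thesis .
qed

text \<open>Sums the Cauchy-Schwarz bound over all \<open>fact n\<close> permutations. The diagonal
  gives the term \<open>n * card S\<close>; each comparable pair is counted for at most
  \<open>8 * fact n / n\<close> permutations.\<close>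

lemma card_comparable_pairs_ge:
  assumes S: "S \<subseteq> typical n"
  shows "n * (card S)\<^sup>2 \<le>
    level_size n n * (n * card S + 8 * card {(x, y) \<in> S \<times> S. comparable x y})"
proof -
  define perms where "perms = {p. p permutes {..<n}}"
  define Q where "Q = {(x, y) \<in> S \<times> S. comparable x y}"
  define same where "same p = {q \<in> Q. p \<in> perms_same_chain n (fst q) (snd q)}" for p
  have S_cube: "S \<subseteq> cube n"
    using S by (auto simp: typical_def)
  then have fin: "finite S" "finite Q" "finite perms"
    using finite_subset[OF S_cube finite_cube] by (auto simp: Q_def perms_def finite_permutations
        intro: finite_subset[of _ "S \<times> S"])
  have card_perms: "card perms = fact n"
    by (simp add: perms_def card_permutations)
  have one: "(card S)\<^sup>2 \<le> level_size n n * (card S + card (same p))" if p: "p \<in> perms" for p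
  proof -
    let ?f = "\<lambda>x. chain_name (permute_list p x)"
    have perm: "p permutes {..<n}"
      using p by (simp add: perms_def)
    have "card (?f ` S) \<le> card (chain_name ` cube n)"
      using S_cube permute_list_in_cube[OF perm]
      by (intro card_mono) (auto simp: finite_cube)
    also note card_chain_names_le
    finally have "(card S)\<^sup>2 \<le> level_size n n * card {(x, y) \<in> S \<times> S. ?f x = ?f y}"
      by (rule card_squared_le_card_same_image[OF fin(1)])
    also have "card {(x, y) \<in> S \<times> S. ?f x = ?f y} \<le> card ((\<lambda>x. (x, x)) ` S \<union> same p)"
    proof (rule card_mono)
      show "finite ((\<lambda>x. (x, x)) ` S \<union> same p)"
        using fin by (simp add: same_def)
      show "{(x, y) \<in> S \<times> S. ?f x = ?f y} \<subseteq> (\<lambda>x. (x, x)) ` S \<union> same p"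
      proof clarify
        fix x y assume xy: "x \<in> S" "y \<in> S" "?f x = ?f y" "(x, y) \<notin> same p"
        have "p \<in> perms_same_chain n x y"
          using xy perm by (simp add: perms_same_chain_def)
        then have "x = y"
          using perms_same_chain_imp_comparable[of x n y p] xy S_cube
          by (auto simp: same_def Q_def)
        then show "(x, y) \<in> (\<lambda>x. (x, x)) ` S"
          using xy by simp
      qed
    qed
    also have "\<dots> \<le> card S + card (same p)"
      using card_Un_le[of "(\<lambda>x. (x, x)) ` S" "same p"] card_image_le[OF fin(1), of "\<lambda>x. (x, x)"]
      by linarith
    finally show ?thesis by simp
  qed
  have "(\<Sum>p\<in>perms. card (same p)) = (\<Sum>q\<in>Q. card {p \<in> perms. p \<in> perms_same_chain n (fst q) (snd q)})"
    unfolding same_def using fin by (intro sum_card_swap) auto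
  also have "\<dots> = (\<Sum>q\<in>Q. card (perms_same_chain n (fst q) (snd q)))"
    by (intro sum.cong arg_cong[where f = card]) (auto simp: perms_def perms_same_chain_def)
  finally have swap: "(\<Sum>p\<in>perms. card (same p)) = (\<Sum>q\<in>Q. card (perms_same_chain n (fst q) (snd q)))" .
  have "n * (\<Sum>q\<in>Q. card (perms_same_chain n (fst q) (snd q))) \<le> (\<Sum>q\<in>Q. 8 * fact n)"
    unfolding sum_distrib_left
  proof (rule sum_mono)
    fix q assume "q \<in> Q"
    then have "fst q \<in> typical n" "snd q \<in> typical n" "comparable (fst q) (snd q)"
      using S by (auto simp: Q_def)
    then show "n * card (perms_same_chain n (fst q) (snd q)) \<le> 8 * fact n"
      by (rule card_perms_same_chain_le_comparable)
  qed
  then have two: "n * (\<Sum>p\<in>perms. card (same p)) \<le> 8 * fact n * card Q"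
    using swap by (simp add: mult_ac)
  have "fact n * (n * (card S)\<^sup>2) = n * (\<Sum>p\<in>perms. (card S)\<^sup>2)"
    by (simp add: card_perms)
  also have "\<dots> \<le> n * (\<Sum>p\<in>perms. level_size n n * (card S + card (same p)))"
    by (intro mult_left_mono sum_mono one) auto
  also have "\<dots> = level_size n n * (n * fact n * card S + n * (\<Sum>p\<in>perms. card (same p)))"
    unfolding sum_distrib_left[symmetric] sum.distrib sum_constant card_perms
    by (simp add: algebra_simps)
  also have "\<dots> \<le> level_size n n * (n * fact n * card S + 8 * fact n * card Q)"
    using two by (intro mult_left_mono add_left_mono) auto
  also have "\<dots> = fact n * (level_size n n * (n * card S + 8 * card Q))"
    by (simp add: algebra_simps)
  finally show ?thesis
    by (simp add: Q_def)
qed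

text \<open>The number of ordered comparable pairs is at most \<open>card S\<close> times the
  maximal degree, so a vertex of maximal degree works.\<close>

lemma ex_large_degree:
  assumes S: "S \<subseteq> typical n" "S \<noteq> {}"
  shows "\<exists>v\<in>S. real n / (8 * real (level_size n n)) * (real (card S) - real (level_size n n)) \<le>
    real (card {w \<in> S. comparable v w})"
proof -
  have fin: "finite S"
    using S finite_subset[OF _ finite_cube[of n]] by (auto simp: typical_def)
  define deg where "deg v = card {w \<in> S. comparable v w}" for v
  define d where "d = Max (deg ` S)"
  define L where "L = level_size n n"
  have "{(x, y) \<in> S \<times> S. comparable x y} = (SIGMA v:S. {w \<in> S. comparable v w})"
    by auto
  then have "card {(x, y) \<in> S \<times> S. comparable x y} = (\<Sum>v\<in>S. deg v)"
    using fin by (simp add: deg_def)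
  also have "\<dots> \<le> (\<Sum>v\<in>S. d)"
    using fin by (intro sum_mono) (simp add: d_def)
  finally have "card {(x, y) \<in> S \<times> S. comparable x y} \<le> card S * d"
    by simp
  then have "L * (n * card S + 8 * card {(x, y) \<in> S \<times> S. comparable x y}) \<le>
      L * (n * card S + 8 * (card S * d))"
    by simp
  with card_comparable_pairs_ge[OF S(1)]
  have "n * (card S)\<^sup>2 \<le> L * (n * card S + 8 * (card S * d))"
    unfolding L_def by (rule order_trans)
  then have "card S * (n * card S) \<le> card S * (L * (n + 8 * d))"
    by (simp add: power2_eq_square algebra_simps)
  then have "n * card S \<le> L * (n + 8 * d)"
    using S(2) fin by (simp add: card_gt_0_iff)
  then have "real (n * card S) \<le> real (L * (n + 8 * d))"
    by (rule of_nat_mono)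
  moreover have "L > 0"
    by (simp add: L_def level_size_pos)
  ultimately have "real n / (8 * real L) * (real (card S) - real L) \<le> real d"
    by (simp add: field_simps)
  moreover have "d \<in> deg ` S"
    unfolding d_def using S fin by (intro Max_in) auto
  ultimately show ?thesis
    by (auto simp: deg_def L_def)
qed

section \<open>Counting independent sets\<close>

definition indep_sets :: "('a \<Rightarrow> 'a \<Rightarrow> bool) \<Rightarrow> 'a set \<Rightarrow> 'a set set" where
  "indep_sets E S = {A. A \<subseteq> S \<and> (\<forall>x\<in>A. \<forall>y\<in>A. \<not> E x y)}"

lemma finite_indep_sets: "finite S \<Longrightarrow> finite (indep_sets E S)"
  unfolding indep_sets_def by simp

lemma card_indep_sets_le_branch:
  assumes "finite S" "v \<in> S"
  shows "card (indep_sets E S) \<le>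
    card (indep_sets E (S - {v})) + card (indep_sets E (S - {v} - {w. E v w}))"
proof -
  let ?A = "{A \<in> indep_sets E S. v \<in> A}" and ?B = "{A \<in> indep_sets E S. v \<notin> A}"
  have "indep_sets E S = ?A \<union> ?B"
    by auto
  then have "card (indep_sets E S) \<le> card ?A + card ?B"
    by (metis card_Un_le)
  moreover have "card ?B \<le> card (indep_sets E (S - {v}))"
    using assms(1) by (intro card_mono finite_indep_sets) (auto simp: indep_sets_def)
  moreover have "card ?A \<le> card (indep_sets E (S - {v} - {w. E v w}))"
  proof (rule card_inj_on_le[where f = "\<lambda>A. A - {v}"])
    show "inj_on (\<lambda>A. A - {v}) ?A"
      by (rule inj_onI) blast
    show "(\<lambda>A. A - {v}) ` ?A \<subseteq> indep_sets E (S - {v} - {w. E v w})"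
      by (auto simp: indep_sets_def)
  qed (use assms(1) in \<open>simp add: finite_indep_sets\<close>)
  ultimately show ?thesis by linarith
qed

text \<open>Every time the vertex \<open>v\<close> of large degree is put into the independent set, the excess
  \<open>card S - L\<close> shrinks by a factor \<open>exp (- \<beta>)\<close>, so this happens at most \<open>k\<close> times. The factor
  \<open>(1 + w) ^ card S / w ^ k\<close> satisfies the resulting recurrence and replaces a sum of binomial
  coefficients.\<close>

lemma card_indep_sets_le_container:
  fixes L \<epsilon> \<beta> w :: real
  assumes "finite S"
    and large_deg: "\<And>T. T \<subseteq> S \<Longrightarrow> (1 + \<epsilon>) * L < real (card T) \<Longrightarrow>
      \<exists>v\<in>T. \<beta> * (real (card T) - L) \<le> real (card {u \<in> T. u \<noteq> v \<and> E v u})"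
    and \<epsilon>: "0 \<le> \<epsilon>" "0 \<le> L" and w: "0 < w" "w \<le> 1"
    and "real (card S) - L \<le> \<epsilon> * L * exp (\<beta> * real k)"
  shows "real (card (indep_sets E S)) \<le> 2 powr ((1 + \<epsilon>) * L) * (1 + w) ^ card S / w ^ k"
  using assms(1,2,7)
proof (induction "card S" arbitrary: S k rule: less_induct)
  case less
  define T where "T = 2 powr ((1 + \<epsilon>) * L)"
  show ?case
  proof (cases "real (card S) \<le> (1 + \<epsilon>) * L")
    case True
    have "card (indep_sets E S) \<le> card (Pow S)"
      using less.prems(1) by (intro card_mono) (auto simp: indep_sets_def)
    then have "real (card (indep_sets E S)) \<le> real (2 ^ card S)"
      using less.prems(1) unfolding of_nat_le_iff by (simp add: card_Pow)
    then have "real (card (indep_sets E S)) \<le> 2 powr real (card S)"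
      by (simp add: powr_realpow)
    also have "\<dots> \<le> T"
      using True by (simp add: T_def)
    also have "\<dots> \<le> T * ((1 + w) ^ card S / w ^ k)"
    proof -
      have "w ^ k \<le> (1 + w) ^ card S"
        using w power_le_one[of w k] one_le_power[of "1 + w" "card S"] by linarith
      then have "1 \<le> (1 + w) ^ card S / w ^ k"
        using w by simp
      then show ?thesis
        using mult_left_mono[of 1 "(1 + w) ^ card S / w ^ k" T] by (simp add: T_def)
    qed
    finally show ?thesis
      by (simp add: T_def)
  next
    case False
    then obtain v where v: "v \<in> S"
      "\<beta> * (real (card S) - L) \<le> real (card {u \<in> S. u \<noteq> v \<and> E v u})"
      using less.prems(2)[of S] by auto
    have excess: "real (card S) - L > \<epsilon> * L"
      using False by (simp add: algebra_simps)
    \<comment> \<open>For \<open>k = 0\<close> the hypothesis would bound the excess by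
      \<open>\<epsilon> * L\<close>, against \<open>excess\<close>.\<close>
    obtain k' where k: "k = Suc k'"
      using excess less.prems(3) by (cases k) auto
    define S1 where "S1 = S - {v}"
    define S2 where "S2 = S - {v} - {u. E v u}"
    define s where "s = card S1"
    have s: "card S = Suc s"
      unfolding S1_def s_def by (rule card.remove[OF less.prems(1) v(1)])
    have fin: "finite S1" "finite S2"
      using less.prems(1) by (auto simp: S1_def S2_def)
    have "S2 \<subseteq> S1"
      by (auto simp: S1_def S2_def)
    then have S2_le: "card S2 \<le> s"
      using fin by (simp add: s_def card_mono)
    have "card S2 + card {u \<in> S. u \<noteq> v \<and> E v u} = card (S2 \<union> {u \<in> S. u \<noteq> v \<and> E v u})"
      using fin less.prems(1) by (intro card_Un_disjoint[symmetric]) (auto simp: S2_def)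
    also have "\<dots> \<le> card S"
      using less.prems(1) by (intro card_mono) (auto simp: S2_def)
    finally have "real (card S2) + real (card {u \<in> S. u \<noteq> v \<and> E v u}) \<le> real (card S)"
      by simp
    then have "real (card S2) - L \<le> (real (card S) - L) * (1 - \<beta>)"
      using v(2) by (simp add: algebra_simps)
    \<comment> \<open>Uses \<open>1 - \<beta> \<le> exp (- \<beta>)\<close>, so that one unit of the
      budget \<open>k\<close> pays for the removed neighbours.\<close>
    also have "\<dots> \<le> (real (card S) - L) * exp (- \<beta>)"
      using exp_ge_add_one_self[of "- \<beta>"] excess mult_nonneg_nonneg[OF \<epsilon>]
      by (intro mult_left_mono) auto
    also have "\<dots> \<le> \<epsilon> * L * exp (\<beta> * real k) * exp (- \<beta>)"
      using less.prems(3) by (intro mult_right_mono) auto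
    also have "\<dots> = \<epsilon> * L * exp (\<beta> * real k')"
      by (simp add: k distrib_left exp_add exp_minus)
    finally have "real (card S2) - L \<le> \<epsilon> * L * exp (\<beta> * real k')" .
    then have "real (card (indep_sets E S2)) \<le> T * (1 + w) ^ card S2 / w ^ k'"
      unfolding T_def using s S2_le fin less.prems(2)
      by (intro less.hyps) (auto simp: S2_def)
    also have "\<dots> \<le> T * (1 + w) ^ s / w ^ k'"
      using S2_le w by (intro divide_right_mono mult_left_mono power_increasing) (auto simp: T_def)
    also have "\<dots> = T * (1 + w) ^ s / w ^ k * w"
      using w by (simp add: k)
    finally have "real (card (indep_sets E S2)) \<le> T * (1 + w) ^ s / w ^ k * w" .
    moreover have "real (card (indep_sets E S1)) \<le> T * (1 + w) ^ s / w ^ k"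
      unfolding T_def s_def using s fin less.prems(2,3)
      by (intro less.hyps) (auto simp: S1_def s_def)
    moreover have "card (indep_sets E S) \<le> card (indep_sets E S1) + card (indep_sets E S2)"
      unfolding S1_def S2_def by (rule card_indep_sets_le_branch[OF less.prems(1) v(1)])
    \<comment> \<open>Excluding \<open>v\<close> keeps \<open>k\<close> and has weight 1; including
      it lowers \<open>k\<close> by one and has weight \<open>w\<close>. Together they supply the
      factor \<open>1 + w\<close> for the removed vertex.\<close>
    ultimately have "real (card (indep_sets E S)) \<le> T * (1 + w) ^ s / w ^ k * (1 + w)"
      unfolding distrib_left mult_1_right by linarith
    then show ?thesis
      by (simp add: T_def s mult_ac)
  qed
qed

section \<open>Atypical vectors\<close>

text \<open>Generating function of the number of coordinates equal to \<open>a\<close>: each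
  coordinate contributes \<open>z\<close> once and 1 twice.\<close>

lemma sum_cube_power_count_list:
  fixes z :: "'a :: comm_semiring_1"
  assumes "a \<in> {0, 1, 2}"
  shows "(\<Sum>x\<in>cube n. z ^ count_list x a) = (2 + z) ^ n"
proof (induction n)
  case (Suc n)
  have "(\<Sum>x\<in>cube (Suc n). z ^ count_list x a) = (\<Sum>x\<in>cube n. (2 + z) * z ^ count_list x a)"
    unfolding sum_cube_Suc using assms
    by (intro sum.cong refl) (auto simp: algebra_simps mult_2)
  then show ?case
    by (simp add: Suc flip: sum_distrib_left)
qed (simp add: cube_0)

text \<open>Exponential Markov bound with the generating function at \<open>z = 1 / 2\<close>. What
  matters is that \<open>11 / 4\<close> is below 3.\<close>

lemma card_few_occurrences_le:
  assumes "a \<in> {0, 1, 2}"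
  shows "real (card {x \<in> cube n. 8 * count_list x a < n}) \<le> (11 / 4) ^ n"
proof -
  let ?B = "{x \<in> cube n. 8 * count_list x a < n}"
  have "real (card ?B) * 2 powr (- (real n / 8)) = (\<Sum>x\<in>?B. 2 powr (- (real n / 8)))"
    by simp
  also have "\<dots> \<le> (\<Sum>x\<in>?B. (1 / 2) ^ count_list x a)"
  proof (rule sum_mono)
    fix x assume "x \<in> ?B"
    then have "2 powr (- (real n / 8)) \<le> 2 powr (- real (count_list x a))"
      by simp
    then show "2 powr (- (real n / 8)) \<le> (1 / 2 :: real) ^ count_list x a"
      by (simp add: powr_minus powr_realpow power_one_over field_simps)
  qed
  also have "\<dots> \<le> (\<Sum>x\<in>cube n. (1 / 2) ^ count_list x a)"
    by (intro sum_mono2) (auto simp: finite_cube)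
  also have "\<dots> = (5 / 2) ^ n"
    using sum_cube_power_count_list[OF assms, of "1 / 2 :: real" n] by simp
  finally have "real (card ?B) \<le> (5 / 2) ^ n * 2 powr (real n / 8)"
    by (simp add: powr_minus field_simps)
  also have "2 powr (real n / 8) = (2 powr (1 / 8)) ^ n"
    by (simp add: powr_powr flip: powr_realpow)
  also have "(5 / 2) ^ n * \<dots> \<le> (5 / 2) ^ n * (11 / 10 :: real) ^ n"
  proof (intro mult_left_mono power_mono)
    \<comment> \<open>The constant is chosen because \<open>(11 / 10) ^ 8\<close> is just above
      2.\<close>
    have "2 powr (1 / 8) \<le> ((11 / 10) ^ 8 :: real) powr (1 / 8)"
      by (intro powr_mono2) (auto simp: field_simps)
    also have "\<dots> = 11 / 10"
      by (simp only: powr_realpow[symmetric] powr_powr) simp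
    finally show "2 powr (1 / 8) \<le> (11 / 10 :: real)" .
  qed auto
  also have "\<dots> = (11 / 4) ^ n"
    by (simp flip: power_mult_distrib)
  finally show ?thesis .
qed

lemma card_atypical_le:
  "real (card (cube n - typical n)) \<le> 2 * (11 / 4) ^ n"
proof -
  let ?B = "\<lambda>a. {x \<in> cube n. 8 * count_list x a < n}"
  have "card (cube n - typical n) \<le> card (?B 0 \<union> ?B 1)"
    by (intro card_mono) (auto simp: typical_def finite_cube)
  also have "\<dots> \<le> card (?B 0) + card (?B 1)"
    by (rule card_Un_le)
  finally show ?thesis
    using card_few_occurrences_le[of 0 n] card_few_occurrences_le[of 1 n] by simp
qed

section \<open>The number of antichains\<close>

text \<open>Comparable vectors with equal sums coincide, so every subset of the middle level is an
  antichain.\<close>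

lemma num_antichains_ge: "2 ^ level_size n n \<le> num_antichains n"
proof -
  let ?M = "{x \<in> cube n. sum_list x = n}"
  have "x = y" if "vec_le x y" "sum_list x = sum_list y" for x y
  proof (rule nth_equalityI)
    show len: "length x = length y"
      using that by (simp add: vec_le_def)
    fix i assume i: "i < length x"
    show "x ! i = y ! i"
    proof (rule ccontr)
      assume "x ! i \<noteq> y ! i"
      then have "(\<Sum>j<length x. x ! j) < (\<Sum>j<length x. y ! j)"
        using that(1) i by (intro sum_strict_mono_ex1) (auto simp: vec_le_def order_less_le)
      with that(2) len show False
        by (simp add: sum_list_sum_nth atLeast0LessThan)
    qed
  qed
  then have "Pow ?M \<subseteq> {A. A \<subseteq> cube n \<and> is_antichain A}"
    unfolding is_antichain_def by (auto simp: subset_iff)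
  moreover have "finite {A. A \<subseteq> cube n \<and> is_antichain A}"
    by (simp add: finite_cube)
  ultimately have "card (Pow ?M) \<le> num_antichains n"
    unfolding num_antichains_def by (intro card_mono)
  then show ?thesis
    by (simp add: card_Pow finite_cube level_size_def)
qed

text \<open>An antichain splits into an atypical part, bounded trivially, and an independent set of
  the comparability graph on the typical vectors.\<close>

lemma num_antichains_le_typical:
  "num_antichains n \<le> 2 ^ card (cube n - typical n) * card (indep_sets comparable (typical n))"
proof -
  have fin: "finite (typical n)"
    by (simp add: typical_def finite_cube)
  have "num_antichains n \<le> card (Pow (cube n - typical n) \<times> indep_sets comparable (typical n))"
    unfolding num_antichains_def
  proof (rule card_inj_on_le[where f = "\<lambda>A. (A - typical n, A \<inter> typical n)"])
    show "inj_on (\<lambda>A. (A - typical n, A \<inter> typical n)) {A. A \<subseteq> cube n \<and> is_antichain A}"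
      by (rule inj_onI) blast
    show "(\<lambda>A. (A - typical n, A \<inter> typical n)) ` {A. A \<subseteq> cube n \<and> is_antichain A} \<subseteq>
        Pow (cube n - typical n) \<times> indep_sets comparable (typical n)"
      by (auto simp: is_antichain_def indep_sets_def comparable_def)
  qed (use fin in \<open>simp add: finite_cube finite_indep_sets\<close>)
  then show ?thesis
    by (simp add: card_cartesian_product card_Pow finite_cube)
qed

text \<open>The container bound with \<open>\<epsilon> = 1 / n\<close> and
  \<open>\<beta> = n / (8 * L)\<close>. The condition on \<open>k\<close> says
  \<open>n ^ 3 \<le> exp (\<beta> * k)\<close>.\<close>

lemma num_antichains_le_powr:
  fixes n k :: nat
  defines "L \<equiv> real (level_size n n)"
  assumes n: "3 \<le> n" and k: "3 * ln (real n) \<le> real n / (8 * L) * real k"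
  shows "real (num_antichains n) \<le>
    2 powr (real (card (cube n - typical n)) + (1 + 1 / n) * L + 2 * 3 ^ n / n ^ 3 + 3 * log 2 n * k)"
proof -
  \<comment> \<open>With this weight \<open>w * 3 ^ n\<close> is only of order
    \<open>L / n ^ 2\<close>, while each unit of \<open>k\<close> costs a factor
    \<open>n ^ 3\<close>.\<close>
  define w where "w = 1 / real n ^ 3"
  have L: "L > 0"
    by (simp add: L_def level_size_pos)
  have w: "0 < w" "w \<le> 1"
    using n by (auto simp: w_def)
  have card_typical: "card (typical n) \<le> 3 ^ n"
    using card_mono[OF finite_cube, of "typical n" n] by (auto simp: typical_def card_cube)
  have "real (card (typical n)) - L \<le> real (3 ^ n)"
    using card_typical L unfolding of_nat_le_iff[where 'a = real, symmetric] by linarith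
  also have "\<dots> \<le> real ((2 * n + 1) * level_size n n)"
    using three_power_le_level_size by (rule of_nat_mono)
  also have "\<dots> = real (2 * n + 1) * L"
    unfolding L_def by (rule of_nat_mult)
  also have "\<dots> \<le> real (n * n) * L"
  proof -
    have "2 * n + 1 \<le> 3 * n"
      using n by simp
    also have "\<dots> \<le> n * n"
      using n by (intro mult_right_mono) auto
    finally show ?thesis
      using L by (intro mult_right_mono of_nat_mono) auto
  qed
  \<comment> \<open>The initial excess is at most \<open>n ^ 2 * L\<close>; reaching
    \<open>L / n\<close> requires a reduction by \<open>n ^ 3\<close>.\<close>
  also have "\<dots> = 1 / n * L * real n ^ 3"
    using n by (simp add: power3_eq_cube)
  also have "\<dots> = 1 / n * L * exp (3 * ln (real n))"
    using n exp_of_nat_mult[of 3 "ln (real n)"] by simp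
  also have "\<dots> \<le> 1 / n * L * exp (real n / (8 * L) * real k)"
    using k L by (intro mult_left_mono) auto
  finally have excess: "real (card (typical n)) - L \<le> 1 / n * L * exp (real n / (8 * L) * real k)" .
  have "real (card (indep_sets comparable (typical n))) \<le>
      2 powr ((1 + 1 / n) * L) * (1 + w) ^ card (typical n) / w ^ k"
  proof (rule card_indep_sets_le_container[OF _ _ _ _ w excess])
    fix T assume T: "T \<subseteq> typical n" "(1 + 1 / n) * L < real (card T)"
    have "0 \<le> (1 + 1 / n) * L"
      using L by simp
    with T have "T \<noteq> {}"
      by auto
    moreover have "{u \<in> T. u \<noteq> v \<and> comparable v u} = {u \<in> T. comparable v u}" for v
      by (auto simp: comparable_def)
    ultimately show "\<exists>v\<in>T. real n / (8 * L) * (real (card T) - L) \<le>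
        real (card {u \<in> T. u \<noteq> v \<and> comparable v u})"
      using ex_large_degree[OF T(1)] by (simp add: L_def)
  qed (use L in \<open>auto simp: typical_def finite_cube\<close>)
  also have "\<dots> \<le> 2 powr ((1 + 1 / n) * L) * 2 powr (2 * 3 ^ n / n ^ 3) * 2 powr (3 * log 2 n * k)"
  proof -
    have "(1 + w) ^ card (typical n) \<le> (1 + w) ^ 3 ^ n"
      using w card_typical by (intro power_increasing) auto
    also have "\<dots> \<le> exp w ^ 3 ^ n"
      using w by (intro power_mono exp_ge_add_one_self) auto
    also have "\<dots> = exp (w * 3 ^ n)"
      by (simp add: mult.commute flip: exp_of_nat_mult)
    also have "\<dots> \<le> exp (2 * ln 2 * (w * 3 ^ n))"
    proof -
      \<comment> \<open>This is \<open>exp 1 \<le> 4\<close>; it passes from base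
        \<open>exp 1\<close> to base 2 at the cost of a factor 2 in the exponent.\<close>
      have "1 \<le> 2 * ln (2 :: real)"
      proof -
        have "exp 1 \<le> (2 ^ 2 :: real)"
          using exp_le by simp
        then have "1 \<le> ln (2 ^ 2 :: real)"
          by (subst ln_ge_iff) auto
        then show ?thesis
          by (simp only: ln_realpow of_nat_numeral)
      qed
      then have "1 * (w * 3 ^ n) \<le> 2 * ln 2 * (w * 3 ^ n)"
        using w by (intro mult_right_mono) auto
      then show ?thesis
        by simp
    qed
    also have "\<dots> = 2 powr (2 * 3 ^ n / n ^ 3)"
      by (simp add: powr_def w_def mult_ac)
    finally have "(1 + w) ^ card (typical n) \<le> 2 powr (2 * 3 ^ n / n ^ 3)" .
    moreover have "1 / w ^ k = 2 powr (3 * log 2 n * k)"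
    proof -
      have "2 powr (3 * log 2 n * k) = (2 powr log 2 n) powr real (3 * k)"
        by (simp add: powr_powr mult_ac)
      also have "\<dots> = real n ^ (3 * k)"
        using n by (simp only: powr_log_cancel powr_realpow)
      also have "\<dots> = 1 / w ^ k"
        by (simp add: w_def power_mult power_one_over)
      finally show ?thesis ..
    qed
    ultimately show ?thesis
      by (simp add: divide_inverse mult_right_mono mult_left_mono)
  qed
  finally have indep: "real (card (indep_sets comparable (typical n))) \<le>
    2 powr ((1 + 1 / n) * L) * 2 powr (2 * 3 ^ n / n ^ 3) * 2 powr (3 * log 2 n * k)" .
  have "real (num_antichains n) \<le>
      2 powr real (card (cube n - typical n)) * real (card (indep_sets comparable (typical n)))"
    using of_nat_mono[OF num_antichains_le_typical[of n], where 'a = real] by (simp add: powr_realpow)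
  also have "\<dots> \<le> 2 powr real (card (cube n - typical n)) *
      (2 powr ((1 + 1 / n) * L) * 2 powr (2 * 3 ^ n / n ^ 3) * 2 powr (3 * log 2 n * k))"
    using indep by (intro mult_left_mono) auto
  finally show ?thesis
    by (simp add: powr_add mult_ac)
qed

text \<open>Divides the exponent by the middle level size, using
  \<open>1 / L \<le> (2 * n + 1) / 3 ^ n\<close>. The dominant term is of order
  \<open>(ln n)\<^sup>2 / n\<close>.\<close>

lemma log_num_antichains_le:
  assumes n: "3 \<le> n"
  shows "log 2 (real (num_antichains n)) / real (level_size n n) - 1 \<le>
    2 * (2 * real n + 1) * (11 / 12) ^ n + 1 / real n +
    2 * (2 * real n + 1) / real n ^ 3 +
    3 * log 2 (real n) * (24 * ln (real n) / real n + (2 * real n + 1) / 3 ^ n)"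
proof -
  define L where "L = real (level_size n n)"
  define B where "B = real (card (cube n - typical n))"
  \<comment> \<open>The least \<open>k\<close> with \<open>3 * ln n \<le> n / (8 * L) * k\<close>,
    whence \<open>24 = 3 * 8\<close>.\<close>
  define k where "k = nat \<lceil>24 * ln (real n) / real n * L\<rceil>"
  have L: "L > 0"
    by (simp add: L_def level_size_pos)
  have ln: "ln (real n) \<ge> 0" "log 2 (real n) \<ge> 0"
    using n by auto
  have "real (3 ^ n) \<le> real ((2 * n + 1) * level_size n n)"
    using three_power_le_level_size by (rule of_nat_mono)
  then have pow_le: "3 ^ n \<le> (2 * real n + 1) * L"
    by (simp add: L_def algebra_simps)
  have "24 * ln (real n) / real n * L \<le> real k"
    unfolding k_def by (rule real_nat_ceiling_ge)
  then have "real n / (8 * L) * (24 * ln (real n) / real n * L) \<le> real n / (8 * L) * real k"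
    using L by (intro mult_left_mono) auto
  then have "3 * ln (real n) \<le> real n / (8 * L) * real k"
    using L n by simp
  then have "real (num_antichains n) \<le>
      2 powr (B + (1 + 1 / n) * L + 2 * 3 ^ n / n ^ 3 + 3 * log 2 n * k)"
    unfolding L_def B_def by (intro num_antichains_le_powr n)
  moreover have "num_antichains n > 0"
    using num_antichains_ge[of n] by (metis bot_nat_0.not_eq_extremum le_zero_eq power_not_zero zero_neq_numeral)
  ultimately have "log 2 (real (num_antichains n)) \<le>
      B + (1 + 1 / n) * L + 2 * 3 ^ n / n ^ 3 + 3 * log 2 n * k"
    by (simp add: log_le_iff)
  then have "log 2 (real (num_antichains n)) / L \<le>
      (B + (1 + 1 / n) * L + 2 * 3 ^ n / n ^ 3 + 3 * log 2 n * k) / L"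
    using L by (intro divide_right_mono) auto
  also have "\<dots> = B / L + (1 + 1 / n) + 2 * (3 ^ n / L) / n ^ 3 + 3 * log 2 n * (k / L)"
    using L by (simp add: add_divide_distrib)
  also have "\<dots> \<le> 2 * (2 * real n + 1) * (11 / 12) ^ n + (1 + 1 / n) +
      2 * (2 * real n + 1) / n ^ 3 +
      3 * log 2 n * (24 * ln (real n) / real n + (2 * real n + 1) / 3 ^ n)"
  proof (intro add_mono mult_left_mono divide_right_mono)
    have inv_L: "1 / L \<le> (2 * real n + 1) / 3 ^ n"
      using pow_le L by (simp add: field_simps)
    have "B / L \<le> (2 * (11 / 4) ^ n) * (1 / L)"
      using card_atypical_le[of n] L by (simp add: B_def divide_right_mono)
    also have "\<dots> \<le> (2 * (11 / 4) ^ n) * ((2 * real n + 1) / 3 ^ n)"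
      using inv_L by (intro mult_left_mono) auto
    also have "\<dots> = 2 * (2 * real n + 1) * ((11 / 4) ^ n / 3 ^ n)"
      by simp
    also have "(11 / 4) ^ n / 3 ^ n = (11 / 12 :: real) ^ n"
      by (simp flip: power_divide)
    finally show "B / L \<le> 2 * (2 * real n + 1) * (11 / 12) ^ n" .
    show "3 ^ n / L \<le> 2 * real n + 1"
      using pow_le L by (simp add: field_simps)
    \<comment> \<open>Rounding up costs at most 1, which after division by \<open>L\<close> is
      exponentially small.\<close>
    have "real k \<le> 24 * ln (real n) / real n * L + 1"
    proof -
      have "0 \<le> 24 * ln (real n) / real n * L"
        using L ln by simp
      then have "0 \<le> \<lceil>24 * ln (real n) / real n * L\<rceil>"
        by (simp add: order_less_le_trans[of "-1 :: real" 0])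
      then show ?thesis
        unfolding k_def by (simp add: of_int_ceiling_le_add_one)
    qed
    then have "k / L \<le> (24 * ln (real n) / real n * L + 1) / L"
      using L by (intro divide_right_mono) auto
    also have "\<dots> = 24 * ln (real n) / real n + 1 / L"
      using L by (simp add: add_divide_distrib)
    also note inv_L
    finally show "k / L \<le> 24 * ln (real n) / real n + (2 * real n + 1) / 3 ^ n"
      by simp
  qed (use ln in auto)
  finally show ?thesis
    by (simp add: L_def)
qed

theorem mainTheorem4:
  "(\<lambda>n::nat. log 2 (real (num_antichains n)) / real (level_size n n) - 1)
     \<in> O(\<lambda>n. sqrt (ln (real n) / real n))"
proof -
  define g where "g n = 2 * (2 * real n + 1) * (11 / 12) ^ n + 1 / real n +
    2 * (2 * real n + 1) / real n ^ 3 +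
    3 * log 2 (real n) * (24 * ln (real n) / real n + (2 * real n + 1) / 3 ^ n)" for n :: nat
  \<comment> \<open>The middle-level lower bound gives the sign, so an upper bound suffices for the
    norm.\<close>
  have nonneg: "0 \<le> log 2 (real (num_antichains n)) / real (level_size n n) - 1" for n
  proof -
    have "2 powr real (level_size n n) \<le> real (num_antichains n)"
      using of_nat_mono[OF num_antichains_ge[of n], where 'a = real] by (simp add: powr_realpow)
    moreover from this have "0 < real (num_antichains n)"
      by (rule less_le_trans[rotated]) simp
    ultimately have "real (level_size n n) \<le> log 2 (real (num_antichains n))"
      by (simp add: le_log_iff)
    then show ?thesis
      using level_size_pos[of n] by (simp add: field_simps)
  qed
  have "(\<lambda>n. log 2 (real (num_antichains n)) / real (level_size n n) - 1) \<in> O(g)"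
  proof (intro bigoI[where c = 1] eventually_sequentiallyI)
    fix n :: nat assume "3 \<le> n"
    then have "log 2 (real (num_antichains n)) / real (level_size n n) - 1 \<le> g n"
      unfolding g_def by (rule log_num_antichains_le)
    with nonneg[of n] show "norm (log 2 (real (num_antichains n)) / real (level_size n n) - 1) \<le>
        1 * norm (g n)"
      by simp
  qed
  \<comment> \<open>Every summand is \<open>O((ln n)\<^sup>2 / n)\<close>, which is of smaller order
    than the square root.\<close>
  also have "g \<in> O(\<lambda>n. sqrt (ln (real n) / real n))"
    unfolding g_def by (intro sum_in_bigo; real_asymp)
  finally show ?thesis .
qed

end
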